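(* There is an absolute constant $C$ such that for all positive integers $n$ and all integers $k\ge 2$ there is a CNF encoding of $\mathsf{AtMostK}(x_1,\dots,x_n)$ using at most $2n + C\sqrt{nk^3\log_k^3 n}$ clauses and at most $C\sqrt{nk^3\log_k^3 n}$ auxiliary variables.
   Context: $\mathsf{AtMostK}(x_1,\dots,x_n)$ is true iff at most $k$ of $x_1,\dots,x_n$ are true; $\log_k$ is the base-$k$ logarithm. A CNF formula is a set of clauses; its size is its number of clauses. For a partial assignment $\tau$, $\varphi|_\tau$ deletes clauses satisfied by $\tau$ and literals falsified by $\tau$. A CNF $\varphi$ over $X\sqcup Y$, $X=(x_1,\dots,x_n)$, encodes $f$ if for every assignment $\tau$ of $X$, $f(\tau)=\top$ iff $\varphi|_\tau$ is satisfiable; variables in $Y$ are auxiliary. *)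

theory Defs
  imports Complex_Main
begin

datatype 'v literal = Pos (var: 'v) | Neg (var: 'v)

type_synonym 'v clause = "'v literal set"
type_synonym 'v cnf = "'v clause set"

definition cnf_over :: "'v set \<Rightarrow> 'v cnf \<Rightarrow> bool" where
  "cnf_over V \<phi> \<longleftrightarrow> finite \<phi> \<and> (\<forall>c\<in>\<phi>. finite c \<and> var ` c \<subseteq> V)"

text \<open>A partial assignment is a map; the variables outside its domain are unassigned.\<close>

type_synonym 'v passign = "'v \<rightharpoonup> bool"

fun lit_true :: "'v passign \<Rightarrow> 'v literal \<Rightarrow> bool" where
  "lit_true \<tau> (Pos v) \<longleftrightarrow> \<tau> v = Some True"
| "lit_true \<tau> (Neg v) \<longleftrightarrow> \<tau> v = Some False"

fun lit_false :: "'v passign \<Rightarrow> 'v literal \<Rightarrow> bool" where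
  "lit_false \<tau> (Pos v) \<longleftrightarrow> \<tau> v = Some False"
| "lit_false \<tau> (Neg v) \<longleftrightarrow> \<tau> v = Some True"

definition cnf_restrict :: "'v cnf \<Rightarrow> 'v passign \<Rightarrow> 'v cnf" where
  "cnf_restrict \<phi> \<tau> = (\<lambda>c. {l \<in> c. \<not> lit_false \<tau> l}) ` {c \<in> \<phi>. \<not> (\<exists>l\<in>c. lit_true \<tau> l)}"

fun lit_holds :: "('v \<Rightarrow> bool) \<Rightarrow> 'v literal \<Rightarrow> bool" where
  "lit_holds \<alpha> (Pos v) \<longleftrightarrow> \<alpha> v"
| "lit_holds \<alpha> (Neg v) \<longleftrightarrow> \<not> \<alpha> v"

definition satisfiable :: "'v cnf \<Rightarrow> bool" where
  "satisfiable \<phi> \<longleftrightarrow> (\<exists>\<alpha>. \<forall>c\<in>\<phi>. \<exists>l\<in>c. lit_holds \<alpha> l)"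

text \<open>
  \<open>xs\<close> lists the input variables \<open>x\<^sub>1, \<dots>, x\<^sub>n\<close> and \<open>Y\<close> is the set of auxiliary variables.
  A Boolean function is a predicate on the list of the values of \<open>x\<^sub>1, \<dots>, x\<^sub>n\<close>.
\<close>

definition encodes :: "'v cnf \<Rightarrow> 'v list \<Rightarrow> 'v set \<Rightarrow> (bool list \<Rightarrow> bool) \<Rightarrow> bool" where
  "encodes \<phi> xs Y f \<longleftrightarrow>
     distinct xs \<and> finite Y \<and> set xs \<inter> Y = {} \<and> cnf_over (set xs \<union> Y) \<phi> \<and>
     (\<forall>\<tau> :: 'v passign. dom \<tau> = set xs \<longrightarrow>
        (f (map (\<lambda>x. the (\<tau> x)) xs) \<longleftrightarrow> satisfiable (cnf_restrict \<phi> \<tau>)))"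

definition at_most :: "nat \<Rightarrow> bool list \<Rightarrow> bool" where
  "at_most k bs \<longleftrightarrow> card {i. i < length bs \<and> bs ! i} \<le> k"

end

theory Submission
  imports Defs "HOL-Algebra.Algebraic_Closure_Type" "HOL-Library.Z2"
begin

text \<open>
  Let \<open>l = \<lceil>log\<^sub>k n\<rceil>\<close> and \<open>d = k l\<close>, and arrange the inputs in a grid with about \<open>sqrt (n d)\<close> columns and
  \<open>sqrt (n / d)\<close> rows. A Reed--Solomon code over a field with \<open>q = \<Theta>(d)\<close> elements assigns to each column
  a word of length \<open>d\<close> such that any two words agree in fewer than \<open>l\<close> positions. There are \<open>d\<close> slots, of
  which at most \<open>k\<close> may be used. A true \<open>x\<^sub>i\<close> marks its column (one clause) and has to occupy some
  slot \<open>j\<close> by storing its row together with the \<open>j\<close>-th code symbol of its column (one clause). A slot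
  stores at most one such pair, and at most one marked column may have the stored symbol at position
  \<open>j\<close>; so a slot determines the row and the column, hence different true inputs use different slots. Conversely, at
  most \<open>k\<close> true inputs can be given distinct slots \<open>j\<close> in which the code separates their column from
  all other marked ones. All constraints not mentioned above cost \<open>O(d)\<close> per column and \<open>O(d q)\<close>
  per row, that is \<open>O(sqrt (n d\<^sup>3))\<close> in total. If \<open>d > n\<close>, then a sequential counter with \<open>O(n k)\<close>
  clauses is already within this bound.
\<close>

section \<open>Reed--Solomon codes\<close>

text \<open>Over an algebraically closed field \<open>p\<close> splits into linear factors, and a
  repeated root would also be a root of \<open>pderiv p\<close>. So every root is simple, and the
  degree counts the distinct roots.\<close>

lemma card_roots_separable:
  fixes p :: "'a :: alg_closed_field poly"
  assumes "p \<noteq> 0" and sep: "\<And>a. poly p a = 0 \<Longrightarrow> poly (pderiv p) a \<noteq> 0"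
  shows "card {x. poly p x = 0} = degree p"
proof -
  obtain A where A: "size A = degree p" "p = smult (lead_coeff p) (\<Prod>x\<in>#A. [:-x, 1:])"
    using alg_closed_imp_factorization[OF \<open>p \<noteq> 0\<close>] by blast
  have "proots p = proots (\<Prod>x\<in>#A. [:-x, 1:])"
    using \<open>p \<noteq> 0\<close> by (subst A(2)) simp
  also have "\<dots> = A"
  proof (induction A)
    case (add x A)
    have "(\<Prod>x\<in>#A. [:-x, 1:]) \<noteq> 0"
      by (auto simp: prod_mset_zero_iff)
    thus ?case
      using add by (simp add: proots_mult del: mult_pCons_left)
  qed simp
  finally have "degree p = size (proots p)"
    using A(1) by simp
  also have "\<dots> = (\<Sum>x | poly p x = 0. order x p)"
    using \<open>p \<noteq> 0\<close> by (simp add: size_multiset_overloaded_eq)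
  also have "\<dots> = (\<Sum>x | poly p x = 0. 1)"
  proof (intro sum.cong refl)
    fix x assume "x \<in> {x. poly p x = 0}"
    hence x: "poly p x = 0" by simp
    have "\<not> 2 \<le> order x p"
    proof
      assume "2 \<le> order x p"
      hence "[:-x, 1:] ^ 2 dvd p"
        using order_divides by blast
      then obtain r where "p = [:-x, 1:] ^ 2 * r" ..
      hence "poly (pderiv p) x = 0"
        by (simp only: pderiv_mult power2_eq_square poly_add poly_mult) simp
      with sep[OF x] show False ..
    qed
    moreover have "order x p \<noteq> 0"
      using x \<open>p \<noteq> 0\<close> by (simp add: order_root)
    ultimately show "order x p = 1" by simp
  qed
  finally show ?thesis by simp
qed

text \<open>The finite field with \<open>2 ^ m\<close> elements, as a set of roots in an algebraic closure.\<close>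

definition gf2 :: "nat \<Rightarrow> bit alg_closure set" where
  "gf2 m = {x. x ^ 2 ^ m = x}"

lemma two_bit_alg_closure: "(2 :: bit alg_closure) = 0"
  by (metis bit_2_eq_0 to_ac_0 to_ac_numeral)

text \<open>This is the iterated Frobenius map: the mixed term of each squaring vanishes in
  characteristic 2. It makes \<open>gf2 m\<close> closed under addition.\<close>

lemma add_power_two_power:
  fixes x y :: "bit alg_closure"
  shows "(x + y) ^ 2 ^ m = x ^ 2 ^ m + y ^ 2 ^ m"
proof (induction m)
  case (Suc m)
  have "(x + y) ^ 2 ^ Suc m = ((x + y) ^ 2 ^ m) ^ 2"
    by (simp add: power_mult[symmetric] mult.commute)
  also have "\<dots> = (x ^ 2 ^ m) ^ 2 + (y ^ 2 ^ m) ^ 2"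
    by (simp add: Suc power2_sum two_bit_alg_closure)
  finally show ?case
    by (simp add: power_mult[symmetric] mult.commute)
qed simp

lemma gf2_add: "x \<in> gf2 m \<Longrightarrow> y \<in> gf2 m \<Longrightarrow> x + y \<in> gf2 m"
  by (simp add: gf2_def add_power_two_power)

lemma gf2_mult: "x \<in> gf2 m \<Longrightarrow> y \<in> gf2 m \<Longrightarrow> x * y \<in> gf2 m"
  by (simp add: gf2_def power_mult_distrib)

lemma card_gf2:
  assumes "m > 0"
  shows "card (gf2 m) = 2 ^ m"
proof -
  define p :: "bit alg_closure poly" where "p = monom 1 (2 ^ m) - monom 1 1"
  have m: "(1::nat) < 2 ^ m"
    using assms by (metis one_less_numeral_iff one_less_power semiring_norm(76))
  have deg: "degree p = 2 ^ m"
  proof (rule antisym)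
    show "degree p \<le> 2 ^ m"
      unfolding p_def using m by (intro degree_diff_le) (auto simp: degree_monom_eq)
    show "2 ^ m \<le> degree p"
      using m by (intro le_degree) (auto simp: p_def)
  qed
  \<comment> \<open>As \<open>m > 0\<close>, the exponent \<open>2 ^ m\<close> vanishes in
    characteristic 2, so only the linear term of \<open>p\<close> survives differentiation and
    \<open>pderiv p\<close> has no root.\<close>
  have "of_nat (2 ^ m) = (0 :: bit alg_closure)"
    using assms by (simp add: two_bit_alg_closure)
  hence "pderiv p = - 1"
    unfolding p_def by (simp add: pderiv_diff pderiv_monom)
  moreover have "p \<noteq> 0"
    using deg m by auto
  moreover have "gf2 m = {x. poly p x = 0}"
    by (auto simp: gf2_def p_def poly_monom)
  ultimately show ?thesis
    using card_roots_separable[of p] deg by simp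
qed

text \<open>Reed--Solomon codes: messages are the coefficient lists of polynomials of degree less than
  \<open>l\<close>, and the symbols of a codeword are the values at \<open>d\<close> fixed points.\<close>

lemma reed_solomon_code:
  assumes "m > 0" "d \<le> 2 ^ m" "M \<le> (2 ^ m) ^ l"
  obtains g :: "nat \<Rightarrow> nat \<Rightarrow> nat" where
    "\<And>u j. u < M \<Longrightarrow> j < d \<Longrightarrow> g u j < 2 ^ m"
    "\<And>u v. u < M \<Longrightarrow> v < M \<Longrightarrow> u \<noteq> v \<Longrightarrow> card {j. j < d \<and> g u j = g v j} < l"
proof -
  let ?F = "gf2 m"
  let ?W = "{ws. set ws \<subseteq> ?F \<and> length ws = l}"
  have cardF: "card ?F = 2 ^ m"
    using assms(1) by (rule card_gf2)
  hence finF: "finite ?F"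
    by (metis card.infinite power_eq_0_iff zero_neq_numeral)
  obtain e where e: "bij_betw e {0..<(2::nat) ^ m} ?F"
    using ex_bij_betw_nat_finite[OF finF] cardF by auto
  \<comment> \<open>There are \<open>(2 ^ m) ^ l\<close> coefficient lists of length
    \<open>l\<close>, enough to give each message its own.\<close>
  have "card {..<M} \<le> card ?W"
    using assms(3) finF cardF by (simp add: card_lists_length_eq)
  then obtain c where c: "c ` {..<M} \<subseteq> ?W" "inj_on c {..<M}"
    using card_le_inj[of "{..<M}" ?W] finite_lists_length_eq[OF finF] by auto
  have F0: "0 \<in> ?F"
    by (simp add: gf2_def)
  have val: "poly (Poly ws) x \<in> ?F" if "set ws \<subseteq> ?F" "x \<in> ?F" for ws x
    using that by (induction ws) (auto simp: F0 gf2_add gf2_mult)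
  let ?g = "\<lambda>u j. inv_into {0..<(2::nat) ^ m} e (poly (Poly (c u)) (e j))"
  have ej: "e j \<in> ?F" if "j < d" for j
    using that assms(2) bij_betwE[OF e] by auto
  have gF: "poly (Poly (c u)) (e j) \<in> e ` {0..<2 ^ m}" if "u < M" "j < d" for u j
    using val[of "c u" "e j"] ej[OF that(2)] c(1) that(1) e by (auto simp: bij_betw_def)
  show thesis
  proof (rule that[of ?g])
    fix u j assume "u < M" "j < d"
    then show "?g u j < 2 ^ m"
      using inv_into_into[OF gF] by auto
  next
    fix u v assume uv: "u < M" "v < M" "u \<noteq> v"
    show "card {j. j < d \<and> ?g u j = ?g v j} < l"
    proof (rule ccontr)
      assume *: "\<not> ?thesis"
      let ?J = "{j. j < d \<and> ?g u j = ?g v j}"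
      have eq: "poly (Poly (c u)) x = poly (Poly (c v)) x" if "x \<in> e ` ?J" for x
        using that gF uv by (auto dest!: inv_into_injective)
      have len: "length (c u) = l" "length (c v) = l"
        using c(1) uv by auto
      have inj: "inj_on e ?J"
        using e assms(2) by (auto simp: bij_betw_def intro: inj_on_subset)
      have "c u \<noteq> c v"
        using c(2) uv by (auto dest: inj_onD)
      hence "l > 0"
        using len by auto
      have deg: "degree (Poly (c w)) < l" if "w < M" for w
      proof -
        have "degree (Poly (c w)) \<le> l - 1"
          using c(1) that by (intro degree_le) (auto simp: coeff_Poly_eq nth_default_def)
        thus ?thesis using \<open>l > 0\<close> by simp
      qed
      \<comment> \<open>Agreement in at least \<open>l\<close> positions would give two polynomials
        of degree below \<open>l\<close> the same values at \<open>l\<close> distinct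
        points.\<close>
      have "Poly (c u) = Poly (c v)"
        using eq by (rule poly_eqI_degree[where A = "e ` ?J"])
          (use deg[OF uv(1)] deg[OF uv(2)] * card_image[OF inj] in auto)
      \<comment> \<open>\<open>Poly\<close> forgets trailing zeros; the common length
        \<open>l\<close> restores the lists from the padded coefficients.\<close>
      hence "nth_default 0 (c u) = nth_default 0 (c v)"
        by (metis coeff_Poly_eq)
      hence "c u ! i = c v ! i" if "i < l" for i
        using that len by (auto simp: nth_default_def fun_eq_iff) (metis that)
      hence "c u = c v"
        using len by (intro nth_equalityI) auto
      with \<open>c u \<noteq> c v\<close> show False ..
    qed
  qed
qed

section \<open>Encodings and sequential counters\<close>

definition models :: "('v \<Rightarrow> bool) \<Rightarrow> 'v cnf \<Rightarrow> bool" where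
  "models \<alpha> \<phi> \<longleftrightarrow> (\<forall>c\<in>\<phi>. \<exists>l\<in>c. lit_holds \<alpha> l)"

lemma models_Un [simp]: "models \<alpha> (\<phi> \<union> \<psi>) \<longleftrightarrow> models \<alpha> \<phi> \<and> models \<alpha> \<psi>"
  by (auto simp: models_def)

lemma models_UN [simp]: "models \<alpha> (\<Union>i\<in>I. \<phi> i) \<longleftrightarrow> (\<forall>i\<in>I. models \<alpha> (\<phi> i))"
  by (auto simp: models_def)

lemma models_image: "models \<alpha> (f ` A) \<longleftrightarrow> (\<forall>a\<in>A. \<exists>l\<in>f a. lit_holds \<alpha> l)"
  by (auto simp: models_def)

lemma cnf_over_Un [simp]: "cnf_over V (\<phi> \<union> \<psi>) \<longleftrightarrow> cnf_over V \<phi> \<and> cnf_over V \<psi>"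
  by (auto simp: cnf_over_def)

lemma cnf_over_UN [simp]:
  "finite I \<Longrightarrow> cnf_over V (\<Union>i\<in>I. \<phi> i) \<longleftrightarrow> (\<forall>i\<in>I. cnf_over V (\<phi> i))"
  unfolding cnf_over_def by (simp add: Ball_def) blast

lemma cnf_over_image:
  "finite A \<Longrightarrow> cnf_over V (f ` A) \<longleftrightarrow> (\<forall>a\<in>A. finite (f a) \<and> literal.var ` f a \<subseteq> V)"
  by (auto simp: cnf_over_def)

text \<open>Overriding a satisfying assignment of the restriction by \<open>\<tau>\<close> keeps the
  surviving literals true, and a model extending \<open>\<tau>\<close> never relies on a deleted
  literal. Later arguments thus need only total assignments.\<close>

lemma satisfiable_cnf_restrict:
  "satisfiable (cnf_restrict \<phi> \<tau>) \<longleftrightarrow>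
     (\<exists>\<alpha>. models \<alpha> \<phi> \<and> (\<forall>x\<in>dom \<tau>. \<tau> x = Some (\<alpha> x)))"
proof
  assume "satisfiable (cnf_restrict \<phi> \<tau>)"
  then obtain \<beta> where \<beta>: "\<forall>c\<in>cnf_restrict \<phi> \<tau>. \<exists>l\<in>c. lit_holds \<beta> l"
    by (auto simp: satisfiable_def)
  define \<alpha> where "\<alpha> x = (case \<tau> x of Some b \<Rightarrow> b | None \<Rightarrow> \<beta> x)" for x
  have "\<exists>l\<in>c. lit_holds \<alpha> l" if "c \<in> \<phi>" for c
  proof (cases "\<exists>l\<in>c. lit_true \<tau> l")
    case True
    then obtain l where "l \<in> c" "lit_true \<tau> l" by blast
    moreover have "lit_holds \<alpha> l"
      using \<open>lit_true \<tau> l\<close> by (cases l) (auto simp: \<alpha>_def)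
    ultimately show ?thesis by blast
  next
    case False
    hence "{l \<in> c. \<not> lit_false \<tau> l} \<in> cnf_restrict \<phi> \<tau>"
      using that by (simp add: cnf_restrict_def)
    hence "\<exists>l\<in>{l \<in> c. \<not> lit_false \<tau> l}. lit_holds \<beta> l"
      by (rule bspec[OF \<beta>])
    then obtain l where l: "l \<in> c" "\<not> lit_false \<tau> l" "lit_holds \<beta> l" by auto
    moreover have "\<not> lit_true \<tau> l"
      using False l by blast
    ultimately have "lit_holds \<alpha> l"
      by (cases l) (auto simp: \<alpha>_def split: option.splits)
    with l show ?thesis by blast
  qed
  hence "models \<alpha> \<phi>"
    by (simp add: models_def)
  moreover have "\<forall>x\<in>dom \<tau>. \<tau> x = Some (\<alpha> x)"
    by (auto simp: \<alpha>_def)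
  ultimately show "\<exists>\<alpha>. models \<alpha> \<phi> \<and> (\<forall>x\<in>dom \<tau>. \<tau> x = Some (\<alpha> x))" by blast
next
  assume "\<exists>\<alpha>. models \<alpha> \<phi> \<and> (\<forall>x\<in>dom \<tau>. \<tau> x = Some (\<alpha> x))"
  then obtain \<alpha> where \<alpha>: "models \<alpha> \<phi>" "\<forall>x\<in>dom \<tau>. \<tau> x = Some (\<alpha> x)" by blast
  have "\<exists>l\<in>c. lit_holds \<alpha> l" if "c \<in> cnf_restrict \<phi> \<tau>" for c
  proof -
    from that obtain c' where c': "c' \<in> \<phi>" "c = {l \<in> c'. \<not> lit_false \<tau> l}"
      by (auto simp: cnf_restrict_def)
    with \<alpha>(1) obtain l where l: "l \<in> c'" "lit_holds \<alpha> l"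
      by (auto simp: models_def)
    have "\<not> lit_false \<tau> l"
      using l(2) \<alpha>(2) by (cases l) (auto simp: dom_def)
    with l c' show ?thesis by blast
  qed
  thus "satisfiable (cnf_restrict \<phi> \<tau>)"
    by (auto simp: satisfiable_def)
qed

text \<open>The input variables are \<open>Inl 0, \<dots>, Inl (n - 1)\<close>, the auxiliary ones \<open>Inr y\<close> for \<open>y \<in> Y\<close>.\<close>

definition at_most_cnf :: "nat \<Rightarrow> nat \<Rightarrow> (nat + 'a) cnf \<Rightarrow> 'a set \<Rightarrow> bool" where
  "at_most_cnf n k \<psi> Y \<longleftrightarrow> finite Y \<and> cnf_over (Inl ` {..<n} \<union> Inr ` Y) \<psi> \<and>
     (\<forall>f. card {i. i < n \<and> f i} \<le> k \<longleftrightarrow> (\<exists>g. models (case_sum f g) \<psi>))"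

lemma lit_holds_map_literal: "lit_holds \<alpha> (map_literal e l) \<longleftrightarrow> lit_holds (\<alpha> \<circ> e) l"
  by (cases l) auto

lemma var_map_literal: "literal.var (map_literal e l) = e (literal.var l)"
  by (cases l) auto

lemma models_cong:
  assumes "cnf_over V \<phi>" "\<And>x. x \<in> V \<Longrightarrow> \<alpha> x = \<beta> x"
  shows "models \<alpha> \<phi> \<longleftrightarrow> models \<beta> \<phi>"
proof -
  have "lit_holds \<alpha> l \<longleftrightarrow> lit_holds \<beta> l" if "c \<in> \<phi>" "l \<in> c" for c l
  proof -
    have "literal.var l \<in> V"
      using assms(1) that by (auto simp: cnf_over_def)
    thus ?thesis
      using assms(2) by (cases l) auto
  qed
  thus ?thesis
    unfolding models_def by blast
qed

text \<open>Renaming the variables injectively carries models over in both directions, so encodings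
  can be built over a convenient sum type.\<close>

lemma encodes_of_at_most_cnf:
  fixes xs :: "nat list" and \<psi> :: "(nat + 'a) cnf"
  assumes "at_most_cnf n k \<psi> Z" "distinct xs" "length xs = n"
  obtains \<phi> :: "nat cnf" and Y where
    "encodes \<phi> xs Y (at_most k)" "card \<phi> \<le> card \<psi>" "card Y = card Z"
proof -
  have fin: "finite Z" and over: "cnf_over (Inl ` {..<n} \<union> Inr ` Z) \<psi>"
    and corr: "\<And>f. card {i. i < n \<and> f i} \<le> k \<longleftrightarrow> (\<exists>g. models (case_sum f g) \<psi>)"
    using assms(1) by (auto simp: at_most_cnf_def)
  obtain r where r: "bij_betw r {0..<card Z} Z"
    using ex_bij_betw_nat_finite[OF fin] by blast
  \<comment> \<open>Auxiliary variables get numbers above all inputs; inserting 0 keeps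
    \<open>Max\<close> defined for empty \<open>xs\<close>.\<close>
  define h where "h z = Suc (Max (insert 0 (set xs))) + inv_into {0..<card Z} r z" for z
  have inj: "inj_on h Z"
    using bij_betw_inv_into[OF r] by (auto simp: h_def inj_on_def bij_betw_def)
  have fresh: "h z \<notin> set xs" for z
  proof
    assume "h z \<in> set xs"
    hence "h z \<le> Max (insert 0 (set xs))" by simp
    thus False by (simp add: h_def)
  qed
  define e where "e = case_sum (\<lambda>i. xs ! i) h"
  define \<phi> where "\<phi> = (\<lambda>c. map_literal e ` c) ` \<psi>"
  have models_\<phi>: "models \<alpha> \<phi> \<longleftrightarrow> models (\<alpha> \<circ> e) \<psi>" for \<alpha>
    by (auto simp: models_def \<phi>_def lit_holds_map_literal)
  have "cnf_over (set xs \<union> h ` Z) \<phi>"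
    unfolding cnf_over_def
  proof (intro conjI ballI)
    show "finite \<phi>"
      using over by (simp add: \<phi>_def cnf_over_def)
    fix c assume "c \<in> \<phi>"
    then obtain c' where c': "c' \<in> \<psi>" "c = map_literal e ` c'"
      by (auto simp: \<phi>_def)
    hence *: "finite c'" "literal.var ` c' \<subseteq> Inl ` {..<n} \<union> Inr ` Z"
      using over by (auto simp: cnf_over_def)
    show "finite c"
      using * c' by simp
    have "literal.var ` c = e ` literal.var ` c'"
      by (simp add: c' image_image var_map_literal)
    also have "\<dots> \<subseteq> e ` (Inl ` {..<n} \<union> Inr ` Z)"
      using * by blast
    also have "\<dots> \<subseteq> set xs \<union> h ` Z"
      using assms(3) by (auto simp: e_def)
    finally show "literal.var ` c \<subseteq> set xs \<union> h ` Z" .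
  qed
  moreover have "at_most k (map (\<lambda>x. the (\<tau> x)) xs) \<longleftrightarrow> satisfiable (cnf_restrict \<phi> \<tau>)"
    if \<tau>: "dom \<tau> = set xs" for \<tau>
  proof -
    define f where "f i = the (\<tau> (xs ! i))" for i
    have "at_most k (map (\<lambda>x. the (\<tau> x)) xs) \<longleftrightarrow> card {i. i < n \<and> f i} \<le> k"
      using assms(3) by (auto simp: at_most_def f_def intro!: arg_cong[where f = "\<lambda>A. card A \<le> k"])
    also have "\<dots> \<longleftrightarrow> (\<exists>g. models (case_sum f g) \<psi>)"
      by (rule corr)
    also have "\<dots> \<longleftrightarrow> (\<exists>\<alpha>. models \<alpha> \<phi> \<and> (\<forall>x\<in>dom \<tau>. \<tau> x = Some (\<alpha> x)))"
    proof
      assume "\<exists>g. models (case_sum f g) \<psi>"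
      then obtain g where g: "models (case_sum f g) \<psi>" ..
      define \<alpha> where "\<alpha> x = (if x \<in> set xs then the (\<tau> x) else g (inv_into Z h x))" for x
      have "models (\<alpha> \<circ> e) \<psi> \<longleftrightarrow> models (case_sum f g) \<psi>"
        using over
        by (rule models_cong)
          (use inj fresh assms(3) in \<open>auto simp: e_def \<alpha>_def f_def inv_into_f_f\<close>)
      with g have "models \<alpha> \<phi>"
        by (simp add: models_\<phi>)
      moreover have "\<forall>x\<in>dom \<tau>. \<tau> x = Some (\<alpha> x)"
        using \<tau> by (auto simp: \<alpha>_def simp flip: \<tau>)
      ultimately show "\<exists>\<alpha>. models \<alpha> \<phi> \<and> (\<forall>x\<in>dom \<tau>. \<tau> x = Some (\<alpha> x))" by blast
    next
      assume "\<exists>\<alpha>. models \<alpha> \<phi> \<and> (\<forall>x\<in>dom \<tau>. \<tau> x = Some (\<alpha> x))"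
      then obtain \<alpha> where \<alpha>: "models \<alpha> \<phi>" "\<forall>x\<in>dom \<tau>. \<tau> x = Some (\<alpha> x)" by blast
      have "models (\<alpha> \<circ> e) \<psi> \<longleftrightarrow> models (case_sum f (\<alpha> \<circ> h)) \<psi>"
        using over
      proof (rule models_cong)
        fix x assume "x \<in> Inl ` {..<n} \<union> Inr ` Z"
        then show "(\<alpha> \<circ> e) x = case_sum f (\<alpha> \<circ> h) x"
          using \<alpha>(2) \<tau> assms(3) by (auto simp: e_def f_def)
      qed
      thus "\<exists>g. models (case_sum f g) \<psi>"
        using \<alpha>(1) models_\<phi> by blast
    qed
    finally show ?thesis
      by (simp add: satisfiable_cnf_restrict)
  qed
  ultimately have "encodes \<phi> xs (h ` Z) (at_most k)"
    unfolding encodes_def using assms(2) fin fresh by auto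
  moreover have "card \<phi> \<le> card \<psi>"
    unfolding \<phi>_def using over by (intro card_image_le) (simp add: cnf_over_def)
  moreover have "card (h ` Z) = card Z"
    by (rule card_image[OF inj])
  ultimately show thesis
    by (rule that)
qed

text \<open>Sequential counter: \<open>s i c\<close> says that at least \<open>c\<close> of \<open>e 0, \<dots>, e (i - 1)\<close> are true.\<close>

definition counter :: "nat \<Rightarrow> nat \<Rightarrow> (nat \<Rightarrow> 'v) \<Rightarrow> (nat \<Rightarrow> nat \<Rightarrow> 'v) \<Rightarrow> 'v cnf" where
  "counter N K e s =
     {{Pos (s 0 0)}, {Neg (s N (Suc K))}} \<union>
     (\<lambda>(i, c). {Neg (s i c), Pos (s (Suc i) c)}) ` ({..<N} \<times> {..Suc K}) \<union>
     (\<lambda>(i, c). {Neg (e i), Neg (s i c), Pos (s (Suc i) (Suc c))}) ` ({..<N} \<times> {..K})"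

lemma models_counter_iff:
  "models \<alpha> (counter N K e s) \<longleftrightarrow> \<alpha> (s 0 0) \<and> \<not> \<alpha> (s N (Suc K)) \<and>
     (\<forall>i<N. \<forall>c\<le>Suc K. \<alpha> (s i c) \<longrightarrow> \<alpha> (s (Suc i) c)) \<and>
     (\<forall>i<N. \<forall>c\<le>K. \<alpha> (e i) \<longrightarrow> \<alpha> (s i c) \<longrightarrow> \<alpha> (s (Suc i) (Suc c)))"
proof -
  have "models \<alpha> {{Pos (s 0 0)}, {Neg (s N (Suc K))}} \<longleftrightarrow> \<alpha> (s 0 0) \<and> \<not> \<alpha> (s N (Suc K))"
    by (simp add: models_def)
  thus ?thesis
    unfolding counter_def models_Un models_image by (simp add: Ball_def) blast
qed

lemma card_prefix_Suc:
  "card {i. i < Suc m \<and> P i} = card {i. i < m \<and> P i} + (if P m then 1 else 0)"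
proof -
  have "{i. i < Suc m \<and> P i} = {i. i < m \<and> P i} \<union> (if P m then {m} else {})"
    by (auto simp: less_Suc_eq)
  thus ?thesis by auto
qed

text \<open>The clauses force the counter variables upwards; a count above \<open>K\<close> would
  make \<open>s N (Suc K)\<close> true against its unit clause.\<close>

lemma counter_sound:
  assumes "models \<alpha> (counter N K e s)"
  shows "card {i. i < N \<and> \<alpha> (e i)} \<le> K"
proof -
  have 0: "\<alpha> (s 0 0)" and fin: "\<not> \<alpha> (s N (Suc K))"
    and keep: "\<And>i c. i < N \<Longrightarrow> c \<le> Suc K \<Longrightarrow> \<alpha> (s i c) \<Longrightarrow> \<alpha> (s (Suc i) c)"
    and inc: "\<And>i c. i < N \<Longrightarrow> c \<le> K \<Longrightarrow> \<alpha> (e i) \<Longrightarrow> \<alpha> (s i c) \<Longrightarrow> \<alpha> (s (Suc i) (Suc c))"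
    using assms unfolding models_counter_iff by blast+
  \<comment> \<open>The count is capped at \<open>Suc K\<close>, the largest value that the clauses
    track.\<close>
  have "\<alpha> (s m (min (Suc K) (card {i. i < m \<and> \<alpha> (e i)})))" if "m \<le> N" for m
    using that
  proof (induction m)
    case (Suc m)
    let ?c = "card {i. i < m \<and> \<alpha> (e i)}"
    have IH: "\<alpha> (s m (min (Suc K) ?c))" and m: "m < N"
      using Suc by auto
    show ?case
    proof (cases "\<alpha> (e m) \<and> ?c \<le> K")
      case True
      hence "\<alpha> (s (Suc m) (Suc ?c))"
        using inc[OF m, of ?c] IH by (simp add: min_def)
      thus ?thesis
        using True by (simp add: card_prefix_Suc min_absorb2)
    next
      case False
      hence "min (Suc K) (card {i. i < Suc m \<and> \<alpha> (e i)}) = min (Suc K) ?c"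
        unfolding card_prefix_Suc by (cases "\<alpha> (e m)") (simp_all add: min_def)
      thus ?thesis
        using keep[OF m _ IH] by simp
    qed
  qed (simp add: 0)
  from this[of N] have "\<alpha> (s N (min (Suc K) (card {i. i < N \<and> \<alpha> (e i)})))"
    by simp
  with fin show ?thesis
    by (metis min_absorb1 not_less_eq_eq)
qed

lemma counter_complete:
  assumes "card {i. i < N \<and> \<alpha> (e i)} \<le> K"
    and "\<And>i c. \<alpha> (s i c) \<longleftrightarrow> c \<le> card {i'. i' < i \<and> \<alpha> (e i')}"
  shows "models \<alpha> (counter N K e s)"
  unfolding models_counter_iff assms(2) card_prefix_Suc using assms(1) by simp

lemma card_counter: "card (counter N K e s) \<le> N * (2 * K + 3) + 2"
proof -
  have "card (counter N K e s) \<le> card {{Pos (s 0 0)}, {Neg (s N (Suc K))}} +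
     card ((\<lambda>(i, c). {Neg (s i c), Pos (s (Suc i) c)}) ` ({..<N} \<times> {..Suc K})) +
     card ((\<lambda>(i, c). {Neg (e i), Neg (s i c), Pos (s (Suc i) (Suc c))}) ` ({..<N} \<times> {..K}))"
    unfolding counter_def by (meson card_Un_le order_trans add_le_mono1)
  also have "\<dots> \<le> 2 + card ({..<N} \<times> {..Suc K}) + card ({..<N} \<times> {..K})"
    by (intro add_mono card_image_le) (auto simp: card_insert_if)
  finally show ?thesis
    by (simp add: algebra_simps)
qed

lemma cnf_over_counter:
  assumes "\<And>i. i < N \<Longrightarrow> e i \<in> V" "\<And>i c. i \<le> N \<Longrightarrow> c \<le> Suc K \<Longrightarrow> s i c \<in> V"
  shows "cnf_over V (counter N K e s)"
  unfolding counter_def cnf_over_Un using assms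
  by (auto simp: cnf_over_image) (auto simp: cnf_over_def)

lemma at_most_cnf_counter:
  "at_most_cnf n k (counter n k Inl (\<lambda>i c. Inr (i, c))) ({..n} \<times> {..Suc k})"
  unfolding at_most_cnf_def
proof (intro conjI allI iffI)
  fix f assume "card {i. i < n \<and> f i} \<le> k"
  hence "models (case_sum f (\<lambda>(i, c). c \<le> card {i'. i' < i \<and> f i'}))
    (counter n k Inl (\<lambda>i c. Inr (i, c)))"
    by (intro counter_complete) auto
  thus "\<exists>g. models (case_sum f g) (counter n k Inl (\<lambda>i c. Inr (i, c)))" by blast
next
  fix f assume "\<exists>g. models (case_sum f g) (counter n k Inl (\<lambda>i c. Inr (i, c)))"
  thus "card {i. i < n \<and> f i} \<le> k"
    by (auto dest: counter_sound)
qed (auto intro!: cnf_over_counter)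

text \<open>This covers in particular \<open>n = 1\<close>, where the logarithm is 0 and the bound
  allows no auxiliary variable.\<close>

lemma at_most_cnf_empty:
  assumes "n \<le> k"
  shows "at_most_cnf n k {} {}"
proof -
  have "card {i. i < n \<and> f i} \<le> k" for f
    using card_mono[of "{..<n}" "{i. i < n \<and> f i}"] assms by fastforce
  thus ?thesis
    by (auto simp: at_most_cnf_def cnf_over_def models_def)
qed

section \<open>The slot encoding\<close>

text \<open>A greedy choice succeeds: the representatives chosen earlier are fewer than the elements
  of the next set.\<close>

lemma distinct_representatives:
  assumes "finite S" "\<And>i. i \<in> S \<Longrightarrow> finite (G i) \<and> card S \<le> card (G i)"
  shows "\<exists>h. inj_on h S \<and> (\<forall>i\<in>S. h i \<in> G i)"
  using assms
proof (induction S rule: finite_induct)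
  case (insert x S)
  have "finite (G i) \<and> card S \<le> card (G i)" if "i \<in> S" for i
    using insert.prems[of i] insert.hyps that by simp
  then obtain h where h: "inj_on h S" "\<forall>i\<in>S. h i \<in> G i"
    using insert.IH by blast
  have "card (h ` S) < card (G x)"
    using insert.prems[of x] insert.hyps card_image[OF h(1)] by simp
  hence "\<not> G x \<subseteq> h ` S"
    using card_mono[of "h ` S" "G x"] insert.hyps by auto
  then obtain y where y: "y \<in> G x" "y \<notin> h ` S" by blast
  have "inj_on (h(x := y)) (insert x S)"
    using h(1) y(2) insert.hyps by (auto simp: inj_on_def)
  moreover have "\<forall>i\<in>insert x S. (h(x := y)) i \<in> G i"
    using h(2) y(1) insert.hyps by auto
  ultimately show ?case by blast
qed simp

text \<open>Variable \<open>x\<^sub>i\<close> sits in column \<open>i mod M\<close> and row \<open>i div M\<close> of a grid. \<open>Col u\<close>: some true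
  variable lies in column \<open>u\<close>. \<open>Row j t\<close>: slot \<open>j\<close> holds a variable in row \<open>t mod A\<close> whose column has
  \<open>j\<close>-th code symbol \<open>t div A\<close>. \<open>Hash j b\<close>: slot \<open>j\<close> uses the code symbol \<open>b\<close>. \<open>Sel j u\<close>: \<open>u\<close> is an
  occupied column with a symbol used by slot \<open>j\<close>. \<open>Used j\<close>: slot \<open>j\<close> is nonempty. The remaining variables
  belong to sequential counters.\<close>

datatype aux = Col nat | Row nat nat | Hash nat nat | Sel nat nat | Used nat
  | Row_Cnt nat nat nat | Sel_Cnt nat nat nat | Used_Cnt nat nat

locale slots =
  fixes n k d q l A M :: nat and g :: "nat \<Rightarrow> nat \<Rightarrow> nat"
  assumes grid: "n \<le> A * M" "M > 0"
    and code_less: "\<And>u j. u < M \<Longrightarrow> j < d \<Longrightarrow> g u j < q"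
    and code_dist: "\<And>u v. u < M \<Longrightarrow> v < M \<Longrightarrow> u \<noteq> v \<Longrightarrow> card {j. j < d \<and> g u j = g v j} < l"
    and l_pos: "l > 0" and slots_ge: "k * l \<le> d"
begin

text \<open>Code symbol and grid row are packed in radix \<open>A\<close>, so storing an input in
  slot \<open>j\<close> is a single literal and the choice of a slot is a single clause.\<close>

definition row :: "nat \<Rightarrow> nat \<Rightarrow> nat" where
  "row i j = g (i mod M) j * A + i div M"

text \<open>These two clauses per input account for the leading term \<open>2 * n\<close> of the
  size.\<close>

definition input_clauses :: "(nat + aux) cnf" where
  "input_clauses =
     (\<lambda>i. {Neg (Inl i), Pos (Inr (Col (i mod M)))}) ` {..<n} \<union>
     (\<lambda>i. insert (Neg (Inl i)) ((\<lambda>j. Pos (Inr (Row j (row i j)))) ` {..<d})) ` {..<n}"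

text \<open>One-directional implications suffice: soundness needs only the forced truths. Counters
  with bound 1 keep the cost of a slot linear in \<open>q * A + M\<close>.\<close>

definition slot_clauses :: "nat \<Rightarrow> (nat + aux) cnf" where
  "slot_clauses j =
     (\<lambda>t. {Neg (Inr (Row j t)), Pos (Inr (Hash j (t div A)))}) ` {..<q * A} \<union>
     (\<lambda>t. {Neg (Inr (Row j t)), Pos (Inr (Used j))}) ` {..<q * A} \<union>
     (\<lambda>u. {Neg (Inr (Col u)), Neg (Inr (Hash j (g u j))), Pos (Inr (Sel j u))}) ` {..<M} \<union>
     counter (q * A) 1 (\<lambda>t. Inr (Row j t)) (\<lambda>i c. Inr (Row_Cnt j i c)) \<union>
     counter M 1 (\<lambda>u. Inr (Sel j u)) (\<lambda>i c. Inr (Sel_Cnt j i c))"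

definition clauses :: "(nat + aux) cnf" where
  "clauses = input_clauses \<union> (\<Union>j\<in>{..<d}. slot_clauses j) \<union>
     counter d k (\<lambda>j. Inr (Used j)) (\<lambda>i c. Inr (Used_Cnt i c))"

definition aux_vars :: "aux set" where
  "aux_vars = Col ` {..<M} \<union> case_prod Row ` ({..<d} \<times> {..<q * A}) \<union>
     case_prod Hash ` ({..<d} \<times> {..<q}) \<union> case_prod Sel ` ({..<d} \<times> {..<M}) \<union> Used ` {..<d} \<union>
     (\<lambda>(j, i, c). Row_Cnt j i c) ` ({..<d} \<times> {..q * A} \<times> {..2}) \<union>
     (\<lambda>(j, i, c). Sel_Cnt j i c) ` ({..<d} \<times> {..M} \<times> {..2}) \<union>
     case_prod Used_Cnt ` ({..d} \<times> {..Suc k})"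

section \<open>Correctness of the slot encoding\<close>

lemma div_M_less: "i < n \<Longrightarrow> i div M < A"
  using grid by (simp add: less_mult_imp_div_less)

lemma mod_M_less: "i mod M < M"
  using grid by simp

lemma row_less:
  assumes "i < n" "j < d"
  shows "row i j < q * A"
proof -
  have "row i j < (g (i mod M) j + 1) * A"
    using div_M_less[OF assms(1)] by (simp add: row_def)
  also have "\<dots> \<le> q * A"
    using code_less[OF mod_M_less assms(2), of i] by (intro mult_right_mono) auto
  finally show ?thesis .
qed

lemma row_div: "i < n \<Longrightarrow> row i j div A = g (i mod M) j"
  using div_M_less[of i] by (simp add: row_def)

lemma row_mod: "i < n \<Longrightarrow> row i j mod A = i div M"
  using div_M_less[of i] by (simp add: row_def)

lemma finite_aux_vars: "finite aux_vars"
  by (simp add: aux_vars_def)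

lemma cnf_over_clauses: "cnf_over (Inl ` {..<n} \<union> Inr ` aux_vars) clauses"
proof -
  let ?V = "Inl ` {..<n} \<union> Inr ` aux_vars :: (nat + aux) set"
  have V: "u < M \<Longrightarrow> Col u \<in> aux_vars" "j < d \<Longrightarrow> t < q * A \<Longrightarrow> Row j t \<in> aux_vars"
    "j < d \<Longrightarrow> b < q \<Longrightarrow> Hash j b \<in> aux_vars" "j < d \<Longrightarrow> u < M \<Longrightarrow> Sel j u \<in> aux_vars"
    "j < d \<Longrightarrow> Used j \<in> aux_vars"
    "j < d \<Longrightarrow> i \<le> q * A \<Longrightarrow> c \<le> 2 \<Longrightarrow> Row_Cnt j i c \<in> aux_vars"
    "j < d \<Longrightarrow> i \<le> M \<Longrightarrow> c \<le> 2 \<Longrightarrow> Sel_Cnt j i c \<in> aux_vars"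
    "i \<le> d \<Longrightarrow> c \<le> Suc k \<Longrightarrow> Used_Cnt i c \<in> aux_vars" for u j t b i c
    unfolding aux_vars_def by (auto simp: image_iff)
  have "cnf_over ?V input_clauses"
    unfolding input_clauses_def
    by (auto simp: cnf_over_image intro!: imageI V mod_M_less row_less)
  moreover have "cnf_over ?V (slot_clauses j)" if "j < d" for j
    unfolding slot_clauses_def cnf_over_Un
    by (intro conjI cnf_over_counter)
      (auto simp: cnf_over_image less_mult_imp_div_less intro!: imageI V code_less that)
  moreover have "cnf_over ?V (counter d k (\<lambda>j. Inr (Used j)) (\<lambda>i c. Inr (Used_Cnt i c)))"
    by (intro cnf_over_counter UnI2 imageI V)
  ultimately show ?thesis
    unfolding clauses_def by simp
qed

text \<open>Choosing for each true input a slot that stores it gives an injection into the used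
  slots, of which there are at most \<open>k\<close>.\<close>

lemma clauses_sound:
  assumes "models (case_sum f s) clauses"
  shows "card {i. i < n \<and> f i} \<le> k"
proof -
  let ?S = "{i. i < n \<and> f i}"
  have inp: "models (case_sum f s) input_clauses"
    and slot: "\<And>j. j < d \<Longrightarrow> models (case_sum f s) (slot_clauses j)"
    and used: "card {j. j < d \<and> s (Used j)} \<le> k"
    using assms counter_sound[of "case_sum f s" d k "\<lambda>j. Inr (Used j)"]
    by (auto simp: clauses_def)
  have col: "s (Col (i mod M))" if "i \<in> ?S" for i
    using inp that unfolding input_clauses_def models_Un models_image by auto
  have "\<exists>j<d. s (Row j (row i j))" if "i \<in> ?S" for i
    using inp that unfolding input_clauses_def models_Un models_image by auto
  then obtain h where h: "\<And>i. i \<in> ?S \<Longrightarrow> h i < d \<and> s (Row (h i) (row i (h i)))"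
    by metis
  have row1: "t = t'" if "j < d" "t < q * A" "s (Row j t)" "t' < q * A" "s (Row j t')" for j t t'
  proof -
    have "card {t. t < q * A \<and> s (Row j t)} \<le> 1"
      using slot[OF that(1)] counter_sound[of "case_sum f s" "q * A" 1 "\<lambda>t. Inr (Row j t)"]
      by (auto simp: slot_clauses_def)
    thus ?thesis
      using that card_le_Suc0_iff_eq[of "{t. t < q * A \<and> s (Row j t)}"] by auto
  qed
  have sel1: "u = u'" if "j < d" "u < M" "s (Sel j u)" "u' < M" "s (Sel j u')" for j u u'
  proof -
    have "card {u. u < M \<and> s (Sel j u)} \<le> 1"
      using slot[OF that(1)] counter_sound[of "case_sum f s" M 1 "\<lambda>u. Inr (Sel j u)"]
      by (auto simp: slot_clauses_def)
    thus ?thesis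
      using that card_le_Suc0_iff_eq[of "{u. u < M \<and> s (Sel j u)}"] by auto
  qed
  have hash: "s (Hash j (t div A))" "s (Used j)" if "j < d" "t < q * A" "s (Row j t)" for j t
    using slot[OF that(1)] that unfolding slot_clauses_def models_Un models_image by auto
  have sel: "s (Sel j u)" if "j < d" "u < M" "s (Col u)" "s (Hash j (g u j))" for j u
    using slot[OF that(1)] that unfolding slot_clauses_def models_Un models_image by auto
  have sel_h: "s (Sel (h i) (i mod M))" if i: "i \<in> ?S" for i
  proof (rule sel)
    show "s (Hash (h i) (g (i mod M) (h i)))"
      using hash(1)[of "h i" "row i (h i)"] h[OF i] i by (simp add: row_less row_div)
  qed (use h[OF i] col[OF i] mod_M_less in auto)
  have "inj_on h ?S"
  proof (rule inj_onI)
    fix i i' assume i: "i \<in> ?S" "i' \<in> ?S" "h i = h i'"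
    \<comment> \<open>The slot holds only one index, so the grid rows agree. Both columns are marked
      and carry the stored symbol, so the \<open>Sel\<close> counter identifies them as
      well.\<close>
    have "row i (h i) = row i' (h i)"
      using h[OF i(1)] h[OF i(2)] i by (intro row1[of "h i"]) (auto simp: row_less)
    hence "i div M = i' div M"
      using i row_mod by (metis mem_Collect_eq)
    moreover have "i mod M = i' mod M"
      using sel_h[OF i(1)] sel_h[OF i(2)] h[OF i(1)] i(3) mod_M_less
      by (intro sel1[of "h i"]) auto
    ultimately show "i = i'"
      by (metis div_mult_mod_eq)
  qed
  moreover have "h ` ?S \<subseteq> {j. j < d \<and> s (Used j)}"
    using h hash(2) row_less by blast
  ultimately have "card ?S \<le> card {j. j < d \<and> s (Used j)}"
    by (intro card_inj_on_le) auto
  with used show ?thesis by simp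
qed

text \<open>Two columns share a code symbol in fewer than \<open>l\<close> positions, so each of at most \<open>k\<close> true
  variables has at least \<open>k l - k (l - 1) = k\<close> slots separating its column from the other ones.\<close>

lemma private_slots:
  assumes "S \<subseteq> {..<n}" "card S \<le> k"
  obtains h where "inj_on h S" "\<And>i. i \<in> S \<Longrightarrow> h i < d"
    "\<And>i i'. i \<in> S \<Longrightarrow> i' \<in> S \<Longrightarrow> g (i' mod M) (h i) = g (i mod M) (h i) \<Longrightarrow> i' mod M = i mod M"
proof -
  \<comment> \<open>Inputs in the same column as \<open>i\<close> do no harm, since the stored row
    tells them apart; only other columns must differ at \<open>j\<close>.\<close>
  define G where "G i = {j. j < d \<and> (\<forall>i'\<in>S. g (i' mod M) j = g (i mod M) j \<longrightarrow> i' mod M = i mod M)}"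
    for i
  have fin: "finite S"
    using assms(1) finite_subset by blast
  have "card S \<le> card (G i)" if i: "i \<in> S" for i
  proof -
    let ?B = "\<lambda>i'. {j. j < d \<and> g (i' mod M) j = g (i mod M) j}"
    let ?S' = "{i' \<in> S. i' mod M \<noteq> i mod M}"
    have "card (\<Union>i'\<in>?S'. ?B i') \<le> (\<Sum>i'\<in>?S'. card (?B i'))"
      using fin by (intro card_UN_le) auto
    also have "\<dots> \<le> (\<Sum>i'\<in>?S'. l - 1)"
    proof (rule sum_mono)
      fix i' assume "i' \<in> ?S'"
      hence "card (?B i') < l"
        by (intro code_dist mod_M_less) auto
      thus "card (?B i') \<le> l - 1" by simp
    qed
    also have "\<dots> \<le> k * (l - 1)"
      using assms(2) card_mono[OF fin, of ?S'] by (auto intro!: mult_right_mono)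
    finally have B: "card (\<Union>i'\<in>?S'. ?B i') \<le> k * (l - 1)" .
    have "G i = {..<d} - (\<Union>i'\<in>?S'. ?B i')"
      by (auto simp: G_def)
    moreover have "finite (\<Union>i'\<in>?S'. ?B i')"
      using fin by simp
    ultimately have "d - card (\<Union>i'\<in>?S'. ?B i') \<le> card (G i)"
      using diff_card_le_card_Diff[of "\<Union>i'\<in>?S'. ?B i'" "{..<d}"] by simp
    moreover have "k * l = k * (l - 1) + k"
      using l_pos by (cases l) auto
    ultimately show ?thesis
      using B slots_ge assms(2) by linarith
  qed
  hence "finite (G i) \<and> card S \<le> card (G i)" if "i \<in> S" for i
    using that by (simp add: G_def)
  then obtain h where "inj_on h S" "\<forall>i\<in>S. h i \<in> G i"
    using distinct_representatives[OF fin, of G] by auto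
  thus thesis
    by (intro that[of h]) (auto simp: G_def)
qed

lemma clauses_complete:
  assumes "card {i. i < n \<and> f i} \<le> k"
  shows "\<exists>s. models (case_sum f s) clauses"
proof -
  let ?S = "{i. i < n \<and> f i}"
  obtain h where inj: "inj_on h ?S" and h: "\<And>i. i \<in> ?S \<Longrightarrow> h i < d"
    and priv: "\<And>i i'. i \<in> ?S \<Longrightarrow> i' \<in> ?S \<Longrightarrow> g (i' mod M) (h i) = g (i mod M) (h i) \<Longrightarrow>
      i' mod M = i mod M"
    using private_slots[of ?S] assms by blast
  define R where "R j t \<longleftrightarrow> (\<exists>i\<in>?S. h i = j \<and> t = row i j)" for j t
  define L where "L j u \<longleftrightarrow> (\<exists>i\<in>?S. h i = j \<and> u = i mod M)" for j u
  define U where "U j \<longleftrightarrow> (\<exists>i\<in>?S. h i = j)" for j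
  define s where "s x = (case x of
      Col u \<Rightarrow> \<exists>i\<in>?S. i mod M = u
    | Row j t \<Rightarrow> R j t
    | Hash j b \<Rightarrow> \<exists>i\<in>?S. h i = j \<and> b = g (i mod M) j
    | Sel j u \<Rightarrow> L j u
    | Used j \<Rightarrow> U j
    | Row_Cnt j i c \<Rightarrow> c \<le> card {t. t < i \<and> R j t}
    | Sel_Cnt j i c \<Rightarrow> c \<le> card {u. u < i \<and> L j u}
    | Used_Cnt i c \<Rightarrow> c \<le> card {j. j < i \<and> U j})" for x
  \<comment> \<open>Injectivity of \<open>h\<close> leaves at most one input per slot, which settles
    both counters with bound 1.\<close>
  have "card {t. t < q * A \<and> R j t} \<le> 1" "card {u. u < M \<and> L j u} \<le> 1" for j
    using inj by (auto simp: card_le_Suc0_iff_eq R_def L_def dest: inj_onD)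
  hence cnt: "models (case_sum f s) (counter (q * A) 1 (\<lambda>t. Inr (Row j t)) (\<lambda>i c. Inr (Row_Cnt j i c)))"
    "models (case_sum f s) (counter M 1 (\<lambda>u. Inr (Sel j u)) (\<lambda>i c. Inr (Sel_Cnt j i c)))" for j
    by (intro counter_complete; simp add: s_def)+
  have "{j. j < d \<and> U j} \<subseteq> h ` ?S"
    by (auto simp: U_def)
  hence "card {j. j < d \<and> U j} \<le> card (h ` ?S)"
    by (intro card_mono) auto
  also have "\<dots> \<le> k"
    using card_image_le[of ?S h] assms by simp
  finally have used: "models (case_sum f s) (counter d k (\<lambda>j. Inr (Used j)) (\<lambda>i c. Inr (Used_Cnt i c)))"
    by (intro counter_complete) (simp_all add: s_def)
  have "models (case_sum f s) input_clauses"
    unfolding input_clauses_def models_Un models_image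
    using h by (auto simp: s_def R_def)
  \<comment> \<open>Privacy is what makes the \<open>Sel\<close> clauses true: a marked column with
    the symbol of slot \<open>j\<close> is the column of the input placed there.\<close>
  moreover have "models (case_sum f s) (slot_clauses j)" for j
    unfolding slot_clauses_def models_Un models_image
    using cnt[of j] priv by (auto simp: s_def R_def L_def U_def row_div)
  ultimately have "models (case_sum f s) clauses"
    unfolding clauses_def using used by simp
  thus ?thesis by blast
qed

lemma at_most_cnf_clauses: "at_most_cnf n k clauses aux_vars"
  unfolding at_most_cnf_def
  using clauses_sound clauses_complete finite_aux_vars cnf_over_clauses by blast

section \<open>Size of the slot encoding\<close>

lemma card_clauses: "card clauses \<le> 2 * n + d * (7 * (q * A) + 6 * M + 4) + d * (2 * k + 3) + 2"
proof -
  have "card input_clauses \<le> n + n"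
    unfolding input_clauses_def
    by (intro order.trans[OF card_Un_le] add_mono order.trans[OF card_image_le]) auto
  moreover have slot: "card (slot_clauses j) \<le> 7 * (q * A) + 6 * M + 4" for j
  proof -
    \<comment> \<open>A counter with bound 1 costs 5 clauses per counted variable and 2 more; this
      gives 7 = 1 + 1 + 5 and 6 = 1 + 5.\<close>
    have "card (slot_clauses j) \<le>
        q * A + q * A + M + (q * A * (2 * 1 + 3) + 2) + (M * (2 * 1 + 3) + 2)"
      unfolding slot_clauses_def
      by (intro order.trans[OF card_Un_le] add_mono order.trans[OF card_image_le] card_counter) auto
    thus ?thesis by (simp add: algebra_simps)
  qed
  have "card (\<Union>j\<in>{..<d}. slot_clauses j) \<le> (\<Sum>j<d. 7 * (q * A) + 6 * M + 4)"
    by (intro order.trans[OF card_UN_le] sum_mono slot) simp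
  ultimately have "card clauses \<le> (n + n) + d * (7 * (q * A) + 6 * M + 4) + (d * (2 * k + 3) + 2)"
    unfolding clauses_def
    by (intro order.trans[OF card_Un_le] add_mono card_counter) auto
  thus ?thesis by simp
qed

lemma card_aux_vars:
  "card aux_vars \<le> M + d * (q * A) + d * q + d * M + d + d * ((q * A + 1) * 3) + d * ((M + 1) * 3) +
     (d + 1) * (k + 2)"
  unfolding aux_vars_def
  by (intro order.trans[OF card_Un_le] add_mono order.trans[OF card_image_le]) auto

end


section \<open>Choice of parameters and final estimates\<close>

lemma sqrt_cube_le_of_le:
  fixes n d x :: real
  assumes "0 \<le> n" "0 \<le> d" "d \<le> 2 * x"
  shows "sqrt (n * d ^ 3) \<le> 3 * sqrt (n * x ^ 3)"
proof -
  have "d ^ 3 \<le> (2 * x) ^ 3"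
    using assms by (intro power_mono) auto
  moreover have "0 \<le> x ^ 3"
    using assms by simp
  moreover have "(2 * x) ^ 3 = 8 * x ^ 3"
    by (simp add: power_mult_distrib)
  \<comment> \<open>8 is relaxed to the perfect square 9, so that the root contributes the factor
    3.\<close>
  ultimately have "d ^ 3 \<le> 9 * x ^ 3"
    by linarith
  hence "n * d ^ 3 \<le> 9 * (n * x ^ 3)"
    using mult_left_mono[of "d ^ 3" "9 * x ^ 3" n] assms(1) by (simp add: mult_ac)
  hence "sqrt (n * d ^ 3) \<le> sqrt (9 * (n * x ^ 3))"
    by simp
  also have "\<dots> = 3 * sqrt (n * x ^ 3)"
    by (simp only: real_sqrt_mult) simp
  finally show ?thesis .
qed

text \<open>For \<open>n \<le> d\<close> the root is at least \<open>n ^ 2\<close>, which dominates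
  the \<open>O(n * k)\<close> size of the plain counter.\<close>

lemma at_most_cnf_many_slots:
  fixes n k d :: nat
  assumes "1 \<le> k" "k < n" "n \<le> d"
  obtains \<psi> :: "(nat + nat \<times> nat) cnf" and Y where
    "at_most_cnf n k \<psi> Y" "real (card \<psi>) \<le> 7 * sqrt (real n * real d ^ 3)"
    "real (card Y) \<le> 7 * sqrt (real n * real d ^ 3)"
proof -
  have "real n ^ 2 = sqrt ((real n ^ 2) ^ 2)"
    by (simp only: real_sqrt_abs) simp
  also have "(real n ^ 2) ^ 2 = real n * real n ^ 3"
    by (simp add: power_numeral_reduce)
  also have "sqrt \<dots> \<le> sqrt (real n * real d ^ 3)"
    using assms by (intro real_sqrt_le_mono mult_left_mono power_mono) auto
  finally have Z: "real (n ^ 2) \<le> sqrt (real n * real d ^ 3)"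
    by simp
  have sq: "n * k \<le> n ^ 2" "n \<le> n ^ 2" "1 \<le> n ^ 2"
    using assms by (auto simp: power2_eq_square)
  let ?\<psi> = "counter n k Inl (\<lambda>i c. Inr (i, c)) :: (nat + nat \<times> nat) cnf"
  have "card ?\<psi> \<le> n * (2 * k + 3) + 2"
    by (rule card_counter)
  also have "\<dots> = 2 * (n * k) + 3 * n + 2"
    by (simp add: algebra_simps)
  also have "\<dots> \<le> 7 * n ^ 2"
    using sq by linarith
  finally have 1: "card ?\<psi> \<le> 7 * n ^ 2" .
  have "card ({..n} \<times> {..Suc k}) = n * k + 2 * n + k + 2"
    by (simp add: algebra_simps)
  also have "\<dots> \<le> 7 * n ^ 2"
    using sq assms(2) by linarith
  finally have 2: "card ({..n} \<times> {..Suc k}) \<le> 7 * n ^ 2" .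
  show thesis
    by (rule that[OF at_most_cnf_counter[of n k]]) (use 1 2 Z in linarith)+
qed

lemma at_most_cnf_few_slots:
  fixes n k l d :: nat
  assumes k: "2 \<le> k" and l: "1 \<le> l" and d: "d = k * l" "d \<le> n" and n: "n \<le> k ^ l"
  obtains \<psi> :: "(nat + aux) cnf" and Y where
    "at_most_cnf n k \<psi> Y" "real (card \<psi>) \<le> 2 * real n + 51 * sqrt (real n * real d ^ 3)"
    "real (card Y) \<le> 43 * sqrt (real n * real d ^ 3)"
proof -
  have "k * 1 \<le> d"
    unfolding d(1) using l by (intro mult_le_mono) auto
  hence kd: "k \<le> d" "2 \<le> d"
    using k by auto
  \<comment> \<open>The field size \<open>q\<close> is the least power of two providing
    \<open>d\<close> evaluation points; it stays below \<open>2 * d\<close>.\<close>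
  then obtain p where p: "2 ^ p < d" "d \<le> 2 ^ (p + 1)"
    using ex_power_ivl2[of 2 d] by auto
  define q where "q = (2::nat) ^ (p + 1)"
  have q: "d \<le> q" "q \<le> 2 * d"
    using p by (auto simp: q_def)
  \<comment> \<open>About \<open>r\<close> columns balance the cost \<open>d * M\<close> of the
    columns against the cost \<open>d * q * A\<close> of the rows, where \<open>q\<close> is of
    order \<open>d\<close> and \<open>A\<close> of order \<open>n / M\<close>.\<close>
  define r where "r = sqrt (real n * real d)"
  define M where "M = nat \<lceil>r\<rceil>"
  define A where "A = n div M + 1"
  have "1 \<le> real n * real d"
    using kd d by (metis of_nat_mult of_nat_1 of_nat_le_iff nat_0_less_mult_iff
      less_le_trans zero_less_numeral Suc_leI One_nat_def)
  hence r1: "1 \<le> r"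
    by (simp add: r_def)
  have "real n * real d \<le> real n * real n"
    using d(2) by (intro mult_left_mono) auto
  hence rn: "r \<le> real n"
    unfolding r_def by (intro real_le_lsqrt) (auto simp: power2_eq_square)
  have M: "r \<le> real M" "real M \<le> 2 * r" "M \<le> n" "0 < M"
    using r1 rn by (auto simp: M_def) linarith+
  define Z where "Z = sqrt (real n * real d ^ 3)"
  have Z: "Z = real d * r"
    by (simp add: Z_def r_def real_sqrt_mult power3_eq_cube)
  have r_sq: "r * r = real n * real d"
    by (simp add: r_def)
  have dr: "real d \<le> r"
    unfolding r_def using d(2) by (intro real_le_rsqrt) (auto simp: power2_eq_square intro!: mult_right_mono)
  \<comment> \<open>There are enough codewords for the columns, as
    \<open>M \<le> n \<le> k ^ l\<close> and \<open>k \<le> d \<le> q\<close>.\<close>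
  have "M \<le> q ^ l"
    using M(3) n power_mono[of k q l] kd q by linarith
  then obtain g :: "nat \<Rightarrow> nat \<Rightarrow> nat" where
    g: "\<And>u j. u < M \<Longrightarrow> j < d \<Longrightarrow> g u j < q"
       "\<And>u v. u < M \<Longrightarrow> v < M \<Longrightarrow> u \<noteq> v \<Longrightarrow> card {j. j < d \<and> g u j = g v j} < l"
    using reed_solomon_code[of "p + 1" d M l] q(1) unfolding q_def by auto
  have grid: "n \<le> A * M"
    unfolding A_def distrib_right
    using div_mult_mod_eq[of n M] mod_less_divisor[OF M(4), of n] by linarith
  interpret slots n k d q l A M g
    by unfold_locales (use grid M g l d in auto)
  \<comment> \<open>The quotient in \<open>A\<close> contributes at most
    \<open>n * d / r = r\<close>, and the extra row contributes \<open>d \<le> r\<close>.\<close>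
  have "real d * real A \<le> 2 * r"
  proof -
    have "real (n div M) \<le> real n / real M"
      by (rule of_nat_div_le_of_nat)
    also have "\<dots> \<le> real n / r"
      using M r1 by (intro divide_left_mono) auto
    finally have "real d * real (n div M) \<le> real d * (real n / r)"
      by (intro mult_left_mono) auto
    also have "\<dots> = r"
      using r_sq r1 by (simp add: field_simps)
    finally show ?thesis
      using dr by (simp add: A_def algebra_simps)
  qed
  hence "real q * (real d * real A) \<le> (2 * real d) * (2 * r)"
    by (rule mult_mono[rotated]) (use q(2) in auto)
  hence dqA: "real (d * (q * A)) \<le> 4 * Z"
    by (simp add: Z mult_ac)
  have "d * (q * 1) \<le> d * (q * A)"
    by (intro mult_le_mono) (auto simp: A_def)
  hence dq: "real (d * q) \<le> real (d * (q * A))"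
    by (simp only: of_nat_le_iff mult_1_right)
  have "real d * real M \<le> real d * (2 * r)"
    using M by (intro mult_left_mono) auto
  hence dM: "real (d * M) \<le> 2 * Z"
    by (simp add: Z)
  have "1 * M \<le> d * M"
    using kd by (intro mult_le_mono) auto
  hence M': "real M \<le> real (d * M)"
    by (simp only: of_nat_le_iff mult_1)
  have "real d * real d \<le> Z"
    unfolding Z using dr by (intro mult_left_mono) auto
  moreover have "real d * real k \<le> real d * real d" "1 * real d \<le> real d * real d"
    using kd by (auto intro!: mult_mono)
  ultimately have dk: "real d * real k \<le> Z" "real d \<le> Z"
    by linarith+
  have small: "real (d * k) \<le> Z" "1 \<le> Z" "real k \<le> Z"
    using dk kd by simp_all
  have "real (card clauses) \<le>
      real (2 * n + d * (7 * (q * A) + 6 * M + 4) + d * (2 * k + 3) + 2)"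
    using card_clauses by (simp only: of_nat_le_iff)
  also have "\<dots> = 2 * real n + 7 * real (d * (q * A)) + 6 * real (d * M) + 2 * real (d * k) +
      7 * real d + 2"
    by (simp add: algebra_simps)
  \<comment> \<open>51 = 7 * 4 + 6 * 2 + 2 + 7 + 2.\<close>
  also have "\<dots> \<le> 2 * real n + 51 * Z"
    using dqA dM dk(2) small by linarith
  finally have 1: "real (card clauses) \<le> 2 * real n + 51 * Z" .
  have "real (card aux_vars) \<le> real (M + d * (q * A) + d * q + d * M + d + d * ((q * A + 1) * 3) +
      d * ((M + 1) * 3) + (d + 1) * (k + 2))"
    using card_aux_vars by (simp only: of_nat_le_iff)
  also have "\<dots> = real M + 4 * real (d * (q * A)) + real (d * q) + 4 * real (d * M) + real (d * k) +
      9 * real d + real k + 2"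
    by (simp add: algebra_simps)
  \<comment> \<open>43 = 2 + 4 * 4 + 4 + 4 * 2 + 1 + 9 + 1 + 2.\<close>
  also have "\<dots> \<le> 43 * Z"
    using dqA dq dM M' dk(2) small by linarith
  finally have 2: "real (card aux_vars) \<le> 43 * Z" .
  show thesis
    using that[OF at_most_cnf_clauses] 1 2 unfolding Z_def by blast
qed

theorem theorem4:
  "\<exists>C :: real. \<forall>(n :: nat) (k :: nat) (xs :: nat list).
     n \<ge> 1 \<longrightarrow> k \<ge> 2 \<longrightarrow> distinct xs \<longrightarrow> length xs = n \<longrightarrow>
     (\<exists>(\<phi> :: nat cnf) (Y :: nat set).
        encodes \<phi> xs Y (at_most k) \<and>
        real (card \<phi>) \<le> 2 * real n + C * sqrt (real n * real k ^ 3 * (log (real k) (real n)) ^ 3) \<and>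
        real (card Y) \<le> C * sqrt (real n * real k ^ 3 * (log (real k) (real n)) ^ 3))"
\<comment> \<open>153 = 3 * 51, where 3 is the loss from rounding the logarithm up.\<close>
proof (intro exI[of _ "153 :: real"] allI impI)
  fix n k :: nat and xs :: "nat list"
  assume n: "n \<ge> 1" and k: "k \<ge> 2" and xs: "distinct xs" "length xs = n"
  define L where "L = log (real k) (real n)"
  define T where "T = sqrt (real n * real k ^ 3 * L ^ 3)"
  have L0: "0 \<le> L"
    using n k by (simp add: L_def)
  hence T0: "0 \<le> T"
    by (simp add: T_def)
  show "\<exists>(\<phi> :: nat cnf) (Y :: nat set). encodes \<phi> xs Y (at_most k) \<and>
      real (card \<phi>) \<le> 2 * real n + 153 * sqrt (real n * real k ^ 3 * log (real k) (real n) ^ 3) \<and>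
      real (card Y) \<le> 153 * sqrt (real n * real k ^ 3 * log (real k) (real n) ^ 3)"
    unfolding L_def[symmetric] T_def[symmetric]
  proof (cases "n \<le> k")
    case True
    obtain \<phi> :: "nat cnf" and Y where "encodes \<phi> xs Y (at_most k)"
      "card \<phi> \<le> card ({} :: (nat + nat) cnf)" "card Y = card ({} :: nat set)"
      using encodes_of_at_most_cnf[OF at_most_cnf_empty[OF True] xs] by blast
    thus "\<exists>(\<phi> :: nat cnf) (Y :: nat set). encodes \<phi> xs Y (at_most k) \<and>
      real (card \<phi>) \<le> 2 * real n + 153 * T \<and> real (card Y) \<le> 153 * T"
      using T0 by (intro exI[of _ \<phi>] exI[of _ Y]) auto
  next
    case False
    define l where "l = nat \<lceil>L\<rceil>"
    define d where "d = k * l"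
    \<comment> \<open>Since \<open>L\<close> exceeds 1, rounding it up at most doubles it.\<close>
    have L1: "1 < L"
      using False k by (simp add: L_def)
    hence l: "1 \<le> l" "L \<le> real l" "real l \<le> 2 * L"
      unfolding l_def by linarith+
    have "real n = real k powr L"
      using n k by (simp add: L_def)
    also have "\<dots> \<le> real k powr real l"
      using l k by (intro powr_mono) auto
    also have "\<dots> = real (k ^ l)"
      using k by (simp add: powr_realpow)
    finally have nk: "n \<le> k ^ l"
      by (simp only: of_nat_le_iff)
    have "real d \<le> 2 * (real k * L)"
      using l k by (simp add: d_def)
    hence "sqrt (real n * real d ^ 3) \<le> 3 * sqrt (real n * (real k * L) ^ 3)"
      by (intro sqrt_cube_le_of_le) auto
    hence Z: "sqrt (real n * real d ^ 3) \<le> 3 * T"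
      by (simp add: T_def power_mult_distrib mult_ac)
    show "\<exists>(\<phi> :: nat cnf) (Y :: nat set). encodes \<phi> xs Y (at_most k) \<and>
      real (card \<phi>) \<le> 2 * real n + 153 * T \<and> real (card Y) \<le> 153 * T"
    proof (cases "d \<le> n")
      case True
      obtain \<psi> :: "(nat + aux) cnf" and Y where \<psi>: "at_most_cnf n k \<psi> Y"
        "real (card \<psi>) \<le> 2 * real n + 51 * sqrt (real n * real d ^ 3)"
        "real (card Y) \<le> 43 * sqrt (real n * real d ^ 3)"
        using at_most_cnf_few_slots[OF k l(1) d_def True nk] by blast
      obtain \<phi> :: "nat cnf" and Y' where \<phi>: "encodes \<phi> xs Y' (at_most k)"
        "card \<phi> \<le> card \<psi>" "card Y' = card Y"
        using encodes_of_at_most_cnf[OF \<psi>(1) xs] by blast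
      have "real (card \<phi>) \<le> 2 * real n + 153 * T" "real (card Y') \<le> 153 * T"
        using \<phi>(2,3) \<psi>(2,3) Z T0 by linarith+
      with \<phi>(1) show ?thesis by blast
    next
      case *: False
      obtain \<psi> :: "(nat + nat \<times> nat) cnf" and Y where \<psi>: "at_most_cnf n k \<psi> Y"
        "real (card \<psi>) \<le> 7 * sqrt (real n * real d ^ 3)"
        "real (card Y) \<le> 7 * sqrt (real n * real d ^ 3)"
        using at_most_cnf_many_slots[of k n d] False * k by auto
      obtain \<phi> :: "nat cnf" and Y' where \<phi>: "encodes \<phi> xs Y' (at_most k)"
        "card \<phi> \<le> card \<psi>" "card Y' = card Y"
        using encodes_of_at_most_cnf[OF \<psi>(1) xs] by blast
      have "real (card \<phi>) \<le> 2 * real n + 153 * T" "real (card Y') \<le> 153 * T"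
        using \<phi>(2,3) \<psi>(2,3) Z T0 by linarith+
      with \<phi>(1) show ?thesis by blast
    qed
  qed
qed

end
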